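(* Let $\phi_i:\mathbb{R}^d\to\mathbb{R}$ be twice differentiable and strictly convex for $i=1,\dots,n$. At each iteration $k$, the update of the Sketched Newton-Raphson (SNR) method with stepsize $\gamma=1$, $$x^{k+1}=x^k-DF(x^k)\mathbf{S}_k\big(\mathbf{S}_k^\top DF(x^k)^\top DF(x^k)\mathbf{S}_k\big)^\dagger\mathbf{S}_k^\top F(x^k),$$ applied to $$F(w;\alpha_1;\cdots;\alpha_n)=\Big[\tfrac1n\sum_{i=1}^n\nabla\phi_i(\alpha_i)\,;\,w-\alpha_1\,;\,\cdots\,;\,w-\alpha_n\Big]$$ at $x^k=(w^k;\alpha_1^k;\cdots;\alpha_n^k)$ with the sketching matrix $$\mathbf{S}_k=\begin{bmatrix}\mathbf{I}_d&0\\ \mathbf{G}(x^k)&\mathbf{I}_{B_n}\end{bmatrix}\in\mathbb{R}^{(n+1)d\times(\tau+1)d},\qquad \mathbf{G}(x^k)=\begin{bmatrix}\frac1n\nabla^2\phi_1(\alpha_1^k)\\ \vdots\\ \frac1n\nabla^2\phi_n(\alpha_n^k)\end{bmatrix},$$ is equal to the update of the Stochastic Newton Method (SNM): $x^{k+1}=(w^{k+1};\alpha_1^{k+1};\cdots;\alpha_n^{k+1})$ with $$w^{k+1}=\Big(\frac1n\sum_{i=1}^n\nabla^2\phi_i(\alpha_i^k)\Big)^{-1}\Big(\frac1n\sum_{i=1}^n\nabla^2\phi_i(\alpha_i^k)\alpha_i^k-\frac1n\sum_{i=1}^n\nabla\phi_i(\alpha_i^k)\Big),$$ $$\alpha_i^{k+1}=\begin{cases}w^{k+1}&\text{if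 }i\in B_n,\\ \alpha_i^k&\text{if }i\notin B_n.\end{cases}$$
   Context: Vectors $x=(w;\alpha_1;\cdots;\alpha_n)\in\mathbb{R}^{(n+1)d}$ are stacked columns with $w,\alpha_i\in\mathbb{R}^d$. $DF(x)\in\mathbb{R}^{(n+1)d\times(n+1)d}$ is the transpose of the Jacobian of $F$ at $x$. $\dagger$ is the Moore-Penrose pseudoinverse. $B_n\subset\{1,\dots,n\}$ is the subset of size $\tau\in\{1,\dots,n\}$ drawn (uniformly at random) at iteration $k$, the same in both updates. Divide $\mathbf{I}_{nd}$ into $n$ consecutive column blocks of size $nd\times d$; $\mathbf{I}_{B_n}\in\mathbb{R}^{nd\times\tau d}$ is the concatenation of the blocks with indices in $B_n$. The inverse in the SNM update is understood to exist. *)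

theory Defs
  imports "HOL-Analysis.Analysis"
begin

definition gradient :: "('a::real_inner \<Rightarrow> real) \<Rightarrow> 'a \<Rightarrow> 'a" where
  "gradient f x = (THE g. GDERIV f x :> g)"

definition hessian :: "(real^'d \<Rightarrow> real) \<Rightarrow> real^'d \<Rightarrow> real^'d^'d" where
  "hessian f x = jacobian (gradient f) (at x)"

definition twice_differentiable :: "(real^'d \<Rightarrow> real) \<Rightarrow> bool" where
  "twice_differentiable f \<longleftrightarrow>
     (\<forall>x. f differentiable (at x)) \<and> (\<forall>x. gradient f differentiable (at x))"

definition strictly_convex :: "('a::real_vector \<Rightarrow> real) \<Rightarrow> bool" where
  "strictly_convex f \<longleftrightarrow>
     (\<forall>x y u v. x \<noteq> y \<and> u > 0 \<and> v > 0 \<and> u + v = 1 \<longrightarrow>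
        f (u *\<^sub>R x + v *\<^sub>R y) < u * f x + v * f y)"

text \<open>The four Penrose equations determine the pseudoinverse uniquely.\<close>

definition is_pinv :: "real^'n^'m \<Rightarrow> real^'m^'n \<Rightarrow> bool" where
  "is_pinv A X \<longleftrightarrow>
     A ** X ** A = A \<and> X ** A ** X = X \<and>
     transpose (A ** X) = A ** X \<and> transpose (X ** A) = X ** A"

definition pinv :: "real^'n^'m \<Rightarrow> real^'m^'n" where
  "pinv A = (THE X. is_pinv A X)"

definition DT :: "(real^'p \<Rightarrow> real^'m) \<Rightarrow> real^'p \<Rightarrow> real^'m^'p" where
  "DT F x = transpose (jacobian F (at x))"

definition snr_step ::
    "real \<Rightarrow> (real^'p \<Rightarrow> real^'m) \<Rightarrow> real^'s^'m \<Rightarrow> real^'p \<Rightarrow> real^'p" where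
  "snr_step \<gamma> F S x =
     x - \<gamma> *\<^sub>R ((DT F x ** S
          ** pinv (transpose S ** transpose (DT F x) ** DT F x ** S)
          ** transpose S) *v F x)"

text \<open>A vector of dimension \<open>(n + 1) * d\<close> is indexed by \<open>'d + 'n \<times> 'd\<close>: \<open>Inl j\<close> is
  coordinate \<open>j\<close> of the leading block and \<open>Inr (i, j)\<close> is coordinate \<open>j\<close> of block \<open>i\<close>.\<close>

definition stack :: "real^'d \<Rightarrow> ('n::finite \<Rightarrow> real^'d) \<Rightarrow> real^('d + 'n \<times> 'd)" where
  "stack w \<alpha> = (\<chi> r. case r of Inl j \<Rightarrow> w $ j | Inr (i, j) \<Rightarrow> \<alpha> i $ j)"

definition w_part :: "real^('d + 'n::finite \<times> 'd::finite) \<Rightarrow> real^'d" where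
  "w_part x = (\<chi> j. x $ Inl j)"

definition \<alpha>_part :: "real^('d + 'n::finite \<times> 'd::finite) \<Rightarrow> 'n \<Rightarrow> real^'d" where
  "\<alpha>_part x i = (\<chi> j. x $ Inr (i, j))"

definition block_matrix ::
    "real^'c1^'r1 \<Rightarrow> real^'c2^'r1 \<Rightarrow> real^'c1^'r2 \<Rightarrow> real^'c2^'r2 \<Rightarrow> real^('c1 + 'c2)^('r1 + 'r2)"
  where
  "block_matrix A B C D =
     (\<chi> r c. case r of
        Inl i \<Rightarrow> (case c of Inl j \<Rightarrow> A $ i $ j | Inr j \<Rightarrow> B $ i $ j)
      | Inr i \<Rightarrow> (case c of Inl j \<Rightarrow> C $ i $ j | Inr j \<Rightarrow> D $ i $ j))"

definition snm_F ::
    "('n::finite \<Rightarrow> real^'d::finite \<Rightarrow> real) \<Rightarrow> real^('d + 'n \<times> 'd) \<Rightarrow> real^('d + 'n \<times> 'd)" where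
  "snm_F \<phi> x =
     stack ((1 / real CARD('n)) *\<^sub>R (\<Sum>i\<in>UNIV. gradient (\<phi> i) (\<alpha>_part x i)))
           (\<lambda>i. w_part x - \<alpha>_part x i)"

definition snm_G ::
    "('n::finite \<Rightarrow> real^'d::finite \<Rightarrow> real) \<Rightarrow> real^('d + 'n \<times> 'd) \<Rightarrow> real^'d^('n \<times> 'd)" where
  "snm_G \<phi> x =
     (\<chi> r c. ((1 / real CARD('n)) *\<^sub>R hessian (\<phi> (fst r)) (\<alpha>_part x (fst r))) $ snd r $ c)"

text \<open>The blocks of columns of the identity selected by a subset \<open>B\<close> of the blocks, where
  \<open>b :: 't \<Rightarrow> 'n\<close> enumerates \<open>B\<close>, so that the size of \<open>B\<close> is \<open>CARD('t)\<close>.\<close>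

definition id_blocks :: "('t::finite \<Rightarrow> 'n::finite) \<Rightarrow> real^('t \<times> 'd::finite)^('n \<times> 'd)" where
  "id_blocks b = (\<chi> r c. (mat 1 :: real^('n \<times> 'd)^('n \<times> 'd)) $ r $ (b (fst c), snd c))"

definition snm_sketch ::
    "('n::finite \<Rightarrow> real^'d \<Rightarrow> real) \<Rightarrow> ('t::finite \<Rightarrow> 'n) \<Rightarrow> real^('d + 'n \<times> 'd)
      \<Rightarrow> real^('d + 't \<times> 'd)^('d + 'n \<times> 'd)" where
  "snm_sketch \<phi> b x = block_matrix (mat 1) 0 (snm_G \<phi> x) (id_blocks b)"

definition mean_hessian ::
    "('n::finite \<Rightarrow> real^'d \<Rightarrow> real) \<Rightarrow> ('n \<Rightarrow> real^'d) \<Rightarrow> real^'d^'d" where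
  "mean_hessian \<phi> \<alpha> = (1 / real CARD('n)) *\<^sub>R (\<Sum>i\<in>UNIV. hessian (\<phi> i) (\<alpha> i))"

definition snm_w ::
    "('n::finite \<Rightarrow> real^'d \<Rightarrow> real) \<Rightarrow> ('n \<Rightarrow> real^'d) \<Rightarrow> real^'d" where
  "snm_w \<phi> \<alpha> =
     matrix_inv (mean_hessian \<phi> \<alpha>) *v
       ((1 / real CARD('n)) *\<^sub>R (\<Sum>i\<in>UNIV. hessian (\<phi> i) (\<alpha> i) *v \<alpha> i)
        - (1 / real CARD('n)) *\<^sub>R (\<Sum>i\<in>UNIV. gradient (\<phi> i) (\<alpha> i)))"

end

theory Submission
  imports Defs
begin

text \<open>Write \<open>J\<close> for the Jacobian of \<open>F\<close> at \<open>x\<close> and \<open>H\<close> for the mean Hessian. Because Hessians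
  are symmetric, the first block row of \<open>S\<^sup>T J\<close> collapses to \<open>(H, 0)\<close>, so \<open>A = J\<^sup>T S\<close> maps
  \<open>(u; v)\<close> to \<open>H u + \<Sum>t. v t\<close> in the leading block and to \<open>- v t\<close> in block \<open>b t\<close>. Hence \<open>A\<close> is
  injective, the pseudoinverse of \<open>A\<^sup>T A\<close> is an inverse, and \<open>A (A\<^sup>T A)\<^sup>\<dagger> A\<^sup>T\<close> fixes the range
  of \<open>A\<close>. The SNM displacement \<open>x - x'\<close> lies in that range and satisfies
  \<open>S\<^sup>T F x = A\<^sup>T (x - x')\<close>, so it is the SNR displacement.\<close>

subsection \<open>Symmetry of the Hessian\<close>

text \<open>The second difference is symmetric in \<open>u\<close> and \<open>v\<close> while its limit form is \<open>u \<bullet> H v\<close>; this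
  gives symmetry of \<open>H\<close> without continuity of the second derivative.\<close>

lemma second_difference_estimate:
  fixes f :: "'a::real_inner \<Rightarrow> real"
  assumes grad: "\<And>y. GDERIV f y :> g y"
    and lin: "linear H"
    and bound: "\<And>h. norm h \<le> t * (norm u + norm v) \<Longrightarrow> norm (g (x + h) - g x - H h) \<le> e * norm h"
    and "t > 0" "e > 0"
  shows "\<bar>f (x + t *\<^sub>R u + t *\<^sub>R v) - f (x + t *\<^sub>R u) - f (x + t *\<^sub>R v) + f x - t\<^sup>2 * (u \<bullet> H v)\<bar>
    \<le> 2 * e * t\<^sup>2 * norm u * (norm u + norm v)"
proof -
  let ?N = "norm u + norm v"
  \<comment> \<open>The second difference is \<open>p t - p 0\<close>, so the mean value theorem
    along \<open>u\<close> turns it into a difference of two gradients.\<close>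
  define p where "p s = f (x + s *\<^sub>R u + t *\<^sub>R v) - f (x + s *\<^sub>R u)" for s
  have fd: "(f has_derivative (\<lambda>h. h \<bullet> g y)) (at y)" for y
    using grad[of y] by (simp add: gderiv_def)
  have der: "(p has_real_derivative (u \<bullet> (g (x + s *\<^sub>R u + t *\<^sub>R v) - g (x + s *\<^sub>R u)))) (at s)" for s
  proof -
    have "((\<lambda>s. f (x + s *\<^sub>R u + t *\<^sub>R v)) has_derivative (\<lambda>r. (r *\<^sub>R u) \<bullet> g (x + s *\<^sub>R u + t *\<^sub>R v))) (at s)"
      by (rule has_derivative_compose[OF _ fd]) (auto intro!: derivative_eq_intros)
    moreover have "((\<lambda>s. f (x + s *\<^sub>R u)) has_derivative (\<lambda>r. (r *\<^sub>R u) \<bullet> g (x + s *\<^sub>R u))) (at s)"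
      by (rule has_derivative_compose[OF _ fd]) (auto intro!: derivative_eq_intros)
    ultimately have "(p has_derivative (\<lambda>r. (r *\<^sub>R u) \<bullet> g (x + s *\<^sub>R u + t *\<^sub>R v) - (r *\<^sub>R u) \<bullet> g (x + s *\<^sub>R u))) (at s)"
      unfolding p_def by (rule has_derivative_diff)
    moreover have "(\<lambda>r. (r *\<^sub>R u) \<bullet> g (x + s *\<^sub>R u + t *\<^sub>R v) - (r *\<^sub>R u) \<bullet> g (x + s *\<^sub>R u))
      = (*) (u \<bullet> (g (x + s *\<^sub>R u + t *\<^sub>R v) - g (x + s *\<^sub>R u)))"
      by (simp add: fun_eq_iff inner_diff_right algebra_simps)
    ultimately show ?thesis by (simp add: has_field_derivative_def)
  qed
  obtain \<xi> where \<xi>: "0 < \<xi>" "\<xi> < t"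
    and eq: "p t - p 0 = (t - 0) * (u \<bullet> (g (x + \<xi> *\<^sub>R u + t *\<^sub>R v) - g (x + \<xi> *\<^sub>R u)))"
    using MVT2[OF \<open>t > 0\<close> der] by blast
  define h1 h2 where "h1 = \<xi> *\<^sub>R u + t *\<^sub>R v" and "h2 = \<xi> *\<^sub>R u"
  have \<xi>u: "\<xi> * norm u \<le> t * norm u"
    using \<xi> by (intro mult_right_mono) auto
  have n1: "norm h1 \<le> t * ?N"
    using norm_triangle_ineq[of "\<xi> *\<^sub>R u" "t *\<^sub>R v"] \<xi> \<xi>u \<open>t > 0\<close>
    by (simp add: h1_def algebra_simps)
  have n2: "norm h2 \<le> t * ?N"
    using \<xi> \<xi>u \<open>t > 0\<close> by (simp add: h2_def distrib_left add_increasing2)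
  have H: "H h1 - H h2 = t *\<^sub>R H v"
    by (simp add: h1_def h2_def linear_add[OF lin] linear_cmul[OF lin])
  \<comment> \<open>\<open>q\<close> is the error of replacing the gradient difference by
    \<open>t *\<^sub>R H v\<close>. Both gradients are expanded around \<open>x\<close>, the only
    point where \<open>g\<close> is known to be differentiable.\<close>
  define q where "q = g (x + h1) - g (x + h2) - t *\<^sub>R H v"
  have "q = (g (x + h1) - g x - H h1) - (g (x + h2) - g x - H h2)"
    unfolding q_def H[symmetric] by simp
  then have "norm q \<le> e * norm h1 + e * norm h2"
    using norm_triangle_ineq4 bound[OF n1] bound[OF n2] by (smt (verit, best))
  also have "\<dots> \<le> e * (t * ?N) + e * (t * ?N)"
    using n1 n2 \<open>e > 0\<close> by (intro add_mono mult_left_mono) auto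
  finally have q: "norm q \<le> 2 * e * t * ?N" by simp
  have "f (x + t *\<^sub>R u + t *\<^sub>R v) - f (x + t *\<^sub>R u) - f (x + t *\<^sub>R v) + f x - t\<^sup>2 * (u \<bullet> H v) = t * (u \<bullet> q)"
    using eq by (simp add: p_def q_def h1_def h2_def inner_diff_right power2_eq_square algebra_simps)
  moreover have "\<bar>t * (u \<bullet> q)\<bar> \<le> t * (norm u * (2 * e * t * ?N))"
    using \<open>t > 0\<close> q Cauchy_Schwarz_ineq2[of u q]
    by (auto simp: abs_mult intro!: mult_left_mono intro: order_trans)
  ultimately show ?thesis by (simp add: power2_eq_square algebra_simps)
qed

lemma derivative_of_gradient_symmetric:
  fixes f :: "'a::real_inner \<Rightarrow> real"
  assumes grad: "\<And>y. GDERIV f y :> g y"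
    and der: "(g has_derivative H) (at x)"
  shows "u \<bullet> H v = v \<bullet> H u"
proof (rule ccontr)
  assume ne: "u \<bullet> H v \<noteq> v \<bullet> H u"
  let ?N = "norm u + norm v"
  have lin: "linear H" using der by (rule has_derivative_linear)
  have "?N > 0"
    using ne lin by (metis add_pos_nonneg inner_zero_left linear_0 inner_zero_right norm_ge_zero zero_less_norm_iff)
  \<comment> \<open>The two estimates below add up to an error of \<open>2 * e * ?N\<^sup>2\<close>
    after division by \<open>t\<^sup>2\<close>; this \<open>e\<close> makes that half of the
    supposed gap.\<close>
  define e where "e = \<bar>u \<bullet> H v - v \<bullet> H u\<bar> / (4 * ?N\<^sup>2)"
  have "e > 0" using ne \<open>?N > 0\<close> by (simp add: e_def)
  obtain d where "d > 0"
    and d: "\<And>y. norm (y - x) < d \<Longrightarrow> norm (g y - g x - H (y - x)) \<le> e * norm (y - x)"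
    using der \<open>e > 0\<close> unfolding has_derivative_at_alt by blast
  \<comment> \<open>Gives \<open>t * ?N = d / 2\<close>, so every increment allowed by
    \<open>bound\<close> stays within the radius \<open>d\<close>.\<close>
  define t where "t = d / (2 * ?N)"
  have "t > 0" using \<open>d > 0\<close> \<open>?N > 0\<close> by (simp add: t_def)
  have tN: "t * ?N < d"
  proof -
    have "t * ?N = d / 2" using \<open>?N > 0\<close> unfolding t_def by (metis less_irrefl nonzero_mult_divide_mult_cancel_right times_divide_eq_left)
    then show ?thesis using \<open>d > 0\<close> by simp
  qed
  have bound: "norm (g (x + h) - g x - H h) \<le> e * norm h" if "norm h \<le> t * ?N" for h
    using d[of "x + h"] that tN by simp
  let ?D = "f (x + t *\<^sub>R u + t *\<^sub>R v) - f (x + t *\<^sub>R u) - f (x + t *\<^sub>R v) + f x"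
  have 1: "\<bar>?D - t\<^sup>2 * (u \<bullet> H v)\<bar> \<le> 2 * e * t\<^sup>2 * norm u * ?N"
    using second_difference_estimate[OF grad lin bound \<open>t > 0\<close> \<open>e > 0\<close>] .
  have "\<bar>f (x + t *\<^sub>R v + t *\<^sub>R u) - f (x + t *\<^sub>R v) - f (x + t *\<^sub>R u) + f x - t\<^sup>2 * (v \<bullet> H u)\<bar>
      \<le> 2 * e * t\<^sup>2 * norm v * (norm v + norm u)"
    by (rule second_difference_estimate[OF grad lin bound \<open>t > 0\<close> \<open>e > 0\<close>]) (simp add: add.commute)
  then have 2: "\<bar>?D - t\<^sup>2 * (v \<bullet> H u)\<bar> \<le> 2 * e * t\<^sup>2 * norm v * ?N"
    by (simp add: algebra_simps)
  have "t\<^sup>2 * \<bar>u \<bullet> H v - v \<bullet> H u\<bar> = \<bar>t\<^sup>2 * (u \<bullet> H v) - t\<^sup>2 * (v \<bullet> H u)\<bar>"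
    by (simp add: abs_mult flip: right_diff_distrib)
  also have "\<dots> \<le> 2 * e * t\<^sup>2 * norm u * ?N + 2 * e * t\<^sup>2 * norm v * ?N"
    using 1 2 by linarith
  also have "\<dots> = t\<^sup>2 * (2 * e * ?N\<^sup>2)" by (simp add: power2_eq_square algebra_simps)
  finally have "\<bar>u \<bullet> H v - v \<bullet> H u\<bar> \<le> 2 * e * ?N\<^sup>2" using \<open>t > 0\<close> by simp
  then show False using ne \<open>?N > 0\<close> by (simp add: e_def)
qed

text \<open>\<open>gradient\<close> is a definite description, so existence and uniqueness are both
  needed; the adjoint of the derivative, applied to 1, represents it as an inner product.\<close>

lemma GDERIV_gradient:
  fixes f :: "real^'d \<Rightarrow> real"
  assumes "f differentiable (at x)"
  shows "GDERIV f x :> gradient f x"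
proof -
  obtain f' where f': "(f has_derivative f') (at x)"
    using assms by (auto simp: differentiable_def)
  let ?g = "adjoint f' 1"
  have g: "GDERIV f x :> ?g"
    using f' adjoint_works[OF has_derivative_linear[OF f'], of _ 1] by (simp add: gderiv_def)
  show ?thesis
    unfolding gradient_def
  proof (rule theI[of "\<lambda>g. GDERIV f x :> g", OF g])
    fix g' assume "GDERIV f x :> g'"
    with g have "(\<lambda>h. h \<bullet> g') = (\<lambda>h. h \<bullet> ?g)"
      unfolding gderiv_def by (metis has_derivative_unique)
    then show "g' = ?g" by (metis vector_eq_ldot)
  qed
qed

lemma has_derivative_gradient:
  assumes "twice_differentiable f"
  shows "(gradient f has_derivative (\<lambda>h. hessian f x *v h)) (at x)"
  using assms by (simp add: twice_differentiable_def hessian_def jacobian_works)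

lemma inner_hessian_commute:
  assumes "twice_differentiable f"
  shows "(hessian f x *v u) \<bullet> v = u \<bullet> (hessian f x *v v)"
proof -
  have "\<And>y. GDERIV f y :> gradient f y"
    using assms by (simp add: twice_differentiable_def GDERIV_gradient)
  from derivative_of_gradient_symmetric[OF this has_derivative_gradient[OF assms]]
  show ?thesis by (metis inner_commute)
qed

subsection \<open>The sketched step for an injective sketch\<close>

text \<open>Keeps products in the form \<open>transpose A *v x\<close>, on which the lemmas below
  rewrite, instead of \<open>x v* A\<close>.\<close>

declare transpose_matrix_vector [simp del]

lemma matrix_inv:
  fixes A :: "real^'n^'n"
  assumes "invertible A"
  shows "A ** matrix_inv A = mat 1" and "matrix_inv A ** A = mat 1"
  using someI_ex[OF assms[unfolded invertible_def]] by (simp_all add: matrix_inv_def)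

lemma is_pinv_matrix_inv:
  fixes A :: "real^'n^'n"
  assumes "invertible A"
  shows "is_pinv A (matrix_inv A)"
  using matrix_inv[OF assms] by (simp add: is_pinv_def transpose_mat)

lemma pinv_eq_matrix_inv:
  fixes A :: "real^'n^'n"
  assumes "invertible A"
  shows "pinv A = matrix_inv A"
  unfolding pinv_def
proof (rule the_equality[of "is_pinv A", OF is_pinv_matrix_inv[OF assms]])
  fix X assume "is_pinv A X"
  \<comment> \<open>Cancelling \<open>A\<close> on both sides of the first Penrose equation isolates
    \<open>X\<close>.\<close>
  then have "matrix_inv A ** (A ** X ** A) ** matrix_inv A = matrix_inv A ** A ** matrix_inv A"
    by (simp add: is_pinv_def)
  then show "X = matrix_inv A"
    using matrix_inv[OF assms] by (metis matrix_mul_assoc matrix_mul_lid matrix_mul_rid)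
qed

lemma inner_transpose_mult:
  fixes A :: "real^'n^'m"
  shows "x \<bullet> (transpose A *v y) = (A *v x) \<bullet> y"
  by (metis adjoint_matrix adjoint_works inner_commute matrix_vector_mul_linear)

text \<open>The quadratic form of the Gram matrix at \<open>z\<close> is the squared norm of
  \<open>A *v z\<close>, so its kernel is that of \<open>A\<close>.\<close>

lemma invertible_gram:
  fixes A :: "real^'n^'m"
  assumes "\<And>z. A *v z = 0 \<Longrightarrow> z = 0"
  shows "invertible (transpose A ** A)"
proof -
  have "z = 0" if "(transpose A ** A) *v z = 0" for z
  proof -
    have "(A *v z) \<bullet> (A *v z) = z \<bullet> ((transpose A ** A) *v z)"
      by (simp add: inner_transpose_mult flip: matrix_vector_mul_assoc)
    then show "z = 0" using that assms by simp
  qed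
  then show ?thesis
    by (simp add: invertible_left_inverse matrix_left_invertible_ker)
qed

text \<open>The last two hypotheses turn \<open>transpose S *v F x\<close> into the Gram matrix
  applied to \<open>z\<close>. The pseudoinverse undoes it, and the step subtracts exactly
  \<open>A *v z\<close>.\<close>

lemma snr_step_eqI:
  fixes F :: "real^'p \<Rightarrow> real^'m" and S :: "real^'s^'m" and x :: "real^'p"
  defines "A \<equiv> DT F x ** S"
  assumes inj: "\<And>z. A *v z = 0 \<Longrightarrow> z = 0"
    and "x - y = A *v z"
    and "transpose S *v F x = transpose A *v (x - y)"
  shows "snr_step 1 F S x = y"
proof -
  let ?M = "transpose A ** A"
  have gram: "invertible ?M" by (rule invertible_gram[OF inj])
  have "transpose S ** transpose (DT F x) ** DT F x ** S = ?M"
    by (simp add: A_def matrix_transpose_mul matrix_mul_assoc)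
  then have "snr_step 1 F S x = x - A *v (pinv ?M *v (transpose S *v F x))"
    by (simp add: snr_step_def A_def matrix_vector_mul_assoc matrix_mul_assoc)
  also have "\<dots> = x - A *v ((matrix_inv ?M ** ?M) *v z)"
    using assms(3,4) pinv_eq_matrix_inv[OF gram]
    by (simp add: matrix_vector_mul_assoc matrix_mul_assoc)
  also have "\<dots> = y"
    using matrix_inv[OF gram] assms(3) by (simp add: algebra_simps)
  finally show ?thesis .
qed

subsection \<open>Stacked vectors\<close>

lemma w_part_stack [simp]: "w_part (stack w \<alpha>) = w"
  by (simp add: w_part_def stack_def vec_eq_iff)

lemma \<alpha>_part_stack [simp]: "\<alpha>_part (stack w \<alpha>) = \<alpha>"
  by (simp add: \<alpha>_part_def stack_def vec_eq_iff fun_eq_iff)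

lemma stack_parts: "stack (w_part x) (\<alpha>_part x) = x"
  by (simp add: w_part_def \<alpha>_part_def stack_def vec_eq_iff split: sum.split)

lemma stack_eq_iff: "stack w \<alpha> = stack w' \<alpha>' \<longleftrightarrow> w = w' \<and> \<alpha> = \<alpha>'"
  by (metis w_part_stack \<alpha>_part_stack)

lemma stack_diff: "stack w \<alpha> - stack w' \<alpha>' = stack (w - w') (\<lambda>i. \<alpha> i - \<alpha>' i)"
  by (simp add: stack_def vec_eq_iff split: sum.split)

lemma stack_0: "stack 0 (\<lambda>_. 0) = 0"
  by (simp add: stack_def vec_eq_iff split: sum.split)

lemma sum_UNIV_stack:
  fixes f :: "'d::finite + 'n::finite \<times> 'd \<Rightarrow> 'a::comm_monoid_add"
  shows "(\<Sum>r\<in>UNIV. f r) = (\<Sum>j\<in>UNIV. f (Inl j)) + (\<Sum>i\<in>UNIV. \<Sum>j\<in>UNIV. f (Inr (i, j)))"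
proof -
  have "(\<Sum>r\<in>UNIV. f r) = (\<Sum>j\<in>UNIV. f (Inl j)) + (\<Sum>p\<in>UNIV. f (Inr p))"
    unfolding UNIV_Plus_UNIV[symmetric] by (subst sum.Plus) simp_all
  also have "(\<Sum>p\<in>UNIV. f (Inr p)) = (\<Sum>i\<in>UNIV. \<Sum>j\<in>UNIV. f (Inr (i, j)))"
    unfolding UNIV_Times_UNIV[symmetric] by (simp add: sum.cartesian_product)
  finally show ?thesis .
qed

lemma inner_stack: "stack w \<alpha> \<bullet> stack w' \<alpha>' = w \<bullet> w' + (\<Sum>i\<in>UNIV. \<alpha> i \<bullet> \<alpha>' i)"
  by (simp add: inner_vec_def sum_UNIV_stack stack_def)

lemma stack_eqI_inner:
  assumes "\<And>u v. stack u v \<bullet> x = stack u v \<bullet> y"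
  shows "x = y"
  using assms by (metis stack_parts vector_eq_ldot)

lemma has_derivative_w_part: "(w_part has_derivative w_part) (at x)"
  by (rule linear_imp_has_derivative) (auto intro!: linearI simp: w_part_def vec_eq_iff)

lemma has_derivative_\<alpha>_part:
  "((\<lambda>x. \<alpha>_part x i) has_derivative (\<lambda>x. \<alpha>_part x i)) (at x)"
  by (rule linear_imp_has_derivative) (auto intro!: linearI simp: \<alpha>_part_def vec_eq_iff)

text \<open>Pairing a stack with a fixed vector gives a finite sum of inner products of its blocks,
  so the componentwise criterion applies.\<close>

lemma has_derivative_stack:
  fixes f :: "'a::real_normed_vector \<Rightarrow> real^'d::finite" and g :: "'n::finite \<Rightarrow> 'a \<Rightarrow> real^'d"
  assumes "(f has_derivative f') (at x)" and "\<And>i. (g i has_derivative g' i) (at x)"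
  shows "((\<lambda>x. stack (f x) (\<lambda>i. g i x)) has_derivative (\<lambda>h. stack (f' h) (\<lambda>i. g' i h))) (at x)"
proof -
  have inner: "stack a c \<bullet> y = a \<bullet> w_part y + (\<Sum>i\<in>UNIV. c i \<bullet> \<alpha>_part y i)"
    for a :: "real^'d" and c :: "'n \<Rightarrow> real^'d" and y
    using inner_stack[of a c "w_part y" "\<alpha>_part y"] by (simp add: stack_parts)
  show ?thesis
    by (subst has_derivative_componentwise_within)
      (auto simp: inner intro!: has_derivative_add has_derivative_sum has_derivative_inner_left assms)
qed

subsection \<open>The Jacobian and the sketching matrix\<close>

lemma has_derivative_snm_F:
  fixes \<phi> :: "'n::finite \<Rightarrow> real^'d::finite \<Rightarrow> real"
  assumes "\<And>i. twice_differentiable (\<phi> i)"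
  shows "(snm_F \<phi> has_derivative (\<lambda>h.
      stack ((1 / real CARD('n)) *\<^sub>R (\<Sum>i\<in>UNIV. hessian (\<phi> i) (\<alpha>_part x i) *v \<alpha>_part h i))
        (\<lambda>i. w_part h - \<alpha>_part h i))) (at x)"
  unfolding snm_F_def
  by (intro has_derivative_stack has_derivative_scaleR_right has_derivative_sum has_derivative_diff
      has_derivative_w_part has_derivative_\<alpha>_part
      has_derivative_compose[OF has_derivative_\<alpha>_part has_derivative_gradient] assms)

lemma transpose_DT_mult:
  fixes \<phi> :: "'n::finite \<Rightarrow> real^'d::finite \<Rightarrow> real"
  assumes "\<And>i. twice_differentiable (\<phi> i)"
  shows "transpose (DT (snm_F \<phi>) x) *v h =
    stack ((1 / real CARD('n)) *\<^sub>R (\<Sum>i\<in>UNIV. hessian (\<phi> i) (\<alpha>_part x i) *v \<alpha>_part h i))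
      (\<lambda>i. w_part h - \<alpha>_part h i)"
proof -
  note der = has_derivative_snm_F[of \<phi> x, OF assms]
  then have "(snm_F \<phi> has_derivative (\<lambda>h. jacobian (snm_F \<phi>) (at x) *v h)) (at x)"
    using jacobian_works differentiable_def by blast
  from has_derivative_unique[OF this der] show ?thesis
    by (simp add: DT_def fun_eq_iff)
qed

text \<open>The identity columns add \<open>v t\<close> to block \<open>b t\<close>; as
  \<open>b\<close> is arbitrary here, block \<open>i\<close> collects a whole fibre of
  \<open>b\<close>.\<close>

lemma snm_sketch_mult:
  fixes \<phi> :: "'n::finite \<Rightarrow> real^'d::finite \<Rightarrow> real" and b :: "'t::finite \<Rightarrow> 'n"
  shows "snm_sketch \<phi> b x *v stack u v =
    stack u (\<lambda>i. (1 / real CARD('n)) *\<^sub>R (hessian (\<phi> i) (\<alpha>_part x i) *v u) + (\<Sum>t | b t = i. v t))"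
proof -
  have id: "(\<Sum>t\<in>UNIV. \<Sum>k\<in>UNIV. if i = b t \<and> j = k then v t $ k else 0) = (\<Sum>t | b t = i. v t $ j)"
    for i j
  proof -
    have "(\<Sum>k\<in>UNIV. if i = b t \<and> j = k then v t $ k else 0) = (if b t = i then v t $ j else 0)" for t
      by (cases "b t = i") auto
    then show ?thesis by (simp add: sum.If_cases)
  qed
  show ?thesis
    by (simp add: vec_eq_iff matrix_vector_mult_def sum_UNIV_stack snm_sketch_def block_matrix_def
        snm_G_def id_blocks_def stack_def mat_def id sum_distrib_left mult.assoc
        if_distrib[of "\<lambda>a. a * _"] split: sum.split cong: if_cong)
qed

text \<open>Summing over the fibres of \<open>b\<close> is adjoint to pulling back along
  \<open>b\<close>.\<close>

lemma sum_inner_fibres: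
  fixes b :: "'t::finite \<Rightarrow> 'n::finite" and v :: "'t \<Rightarrow> 'a::real_inner"
  shows "(\<Sum>i\<in>UNIV. (\<Sum>t | b t = i. v t) \<bullet> q i) = (\<Sum>t\<in>UNIV. v t \<bullet> q (b t))"
proof -
  have "(\<Sum>i\<in>UNIV. (\<Sum>t | b t = i. v t) \<bullet> q i) = (\<Sum>i\<in>UNIV. \<Sum>t | b t = i. v t \<bullet> q (b t))"
    by (auto simp: inner_sum_left intro!: sum.cong)
  also have "\<dots> = (\<Sum>t\<in>UNIV. v t \<bullet> q (b t))"
    using sum.group[of UNIV UNIV b "\<lambda>t. v t \<bullet> q (b t)"] by simp
  finally show ?thesis .
qed

lemma mean_hessian_mult:
  fixes \<phi> :: "'n::finite \<Rightarrow> real^'d::finite \<Rightarrow> real"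
  shows "mean_hessian \<phi> \<alpha> *v u = (1 / real CARD('n)) *\<^sub>R (\<Sum>i\<in>UNIV. hessian (\<phi> i) (\<alpha> i) *v u)"
proof -
  have "(\<Sum>i\<in>I. A i) *v u = (\<Sum>i\<in>I. A i *v u)" for A :: "'n \<Rightarrow> real^'d^'d" and I
    by (induction I rule: infinite_finite_induct) (auto simp: matrix_vector_mult_add_rdistrib)
  then show ?thesis by (simp add: mean_hessian_def scaleR_matrix_vector_assoc[symmetric])
qed

text \<open>Computed as the adjoint of \<open>snm_sketch_mult\<close>; symmetry of each Hessian
  removes the transposes on the blocks of \<open>snm_G\<close>.\<close>

lemma transpose_snm_sketch_mult:
  fixes \<phi> :: "'n::finite \<Rightarrow> real^'d::finite \<Rightarrow> real" and b :: "'t::finite \<Rightarrow> 'n"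
  assumes "\<And>i. twice_differentiable (\<phi> i)"
  shows "transpose (snm_sketch \<phi> b x) *v stack p q =
    stack (p + (1 / real CARD('n)) *\<^sub>R (\<Sum>i\<in>UNIV. hessian (\<phi> i) (\<alpha>_part x i) *v q i)) (\<lambda>t. q (b t))"
  by (rule stack_eqI_inner)
    (simp add: inner_transpose_mult snm_sketch_mult inner_stack inner_add_left inner_add_right
      sum.distrib sum_inner_fibres inner_hessian_commute[OF assms] inner_sum_right sum_distrib_left)

text \<open>This is what the block \<open>snm_G\<close> is designed for: the Hessian terms in
  \<open>q\<close> from the first Jacobian row cancel against those from the rows
  \<open>p - q i\<close>.\<close>

lemma transpose_sketched_DT_mult:
  fixes \<phi> :: "'n::finite \<Rightarrow> real^'d::finite \<Rightarrow> real" and b :: "'t::finite \<Rightarrow> 'n"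
  assumes "\<And>i. twice_differentiable (\<phi> i)"
  shows "transpose (DT (snm_F \<phi>) x ** snm_sketch \<phi> b x) *v stack p q =
    stack (mean_hessian \<phi> (\<alpha>_part x) *v p) (\<lambda>t. p - q (b t))"
  by (simp add: matrix_transpose_mul transpose_DT_mult[OF assms] transpose_snm_sketch_mult[OF assms]
      mean_hessian_mult matrix_vector_mult_diff_distrib sum_subtractf algebra_simps
      flip: matrix_vector_mul_assoc)

text \<open>Read off from the transpose by testing against all stacks, using that the mean Hessian
  is symmetric.\<close>

lemma sketched_DT_mult:
  fixes \<phi> :: "'n::finite \<Rightarrow> real^'d::finite \<Rightarrow> real" and b :: "'t::finite \<Rightarrow> 'n"
  assumes "\<And>i. twice_differentiable (\<phi> i)"
  shows "(DT (snm_F \<phi>) x ** snm_sketch \<phi> b x) *v stack u v =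
    stack (mean_hessian \<phi> (\<alpha>_part x) *v u + (\<Sum>t\<in>UNIV. v t)) (\<lambda>i. - (\<Sum>t | b t = i. v t))"
    (is "?A *v _ = _")
proof (rule stack_eqI_inner)
  fix p q
  have sym: "(mean_hessian \<phi> (\<alpha>_part x) *v p) \<bullet> u = p \<bullet> (mean_hessian \<phi> (\<alpha>_part x) *v u)"
    by (simp add: mean_hessian_mult inner_sum_left inner_sum_right inner_hessian_commute[OF assms])
  have "stack p q \<bullet> (?A *v stack u v) = (transpose ?A *v stack p q) \<bullet> stack u v"
    using inner_transpose_mult[of "stack u v" ?A "stack p q"] by (simp add: inner_commute)
  also have "\<dots> = p \<bullet> (mean_hessian \<phi> (\<alpha>_part x) *v u) + (\<Sum>t\<in>UNIV. p \<bullet> v t) - (\<Sum>t\<in>UNIV. v t \<bullet> q (b t))"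
    by (simp add: transpose_sketched_DT_mult[OF assms] inner_stack sym inner_diff_left sum_subtractf
        inner_commute[of "q _"])
  also have "\<dots> = stack p q \<bullet> stack (mean_hessian \<phi> (\<alpha>_part x) *v u + (\<Sum>t\<in>UNIV. v t))
      (\<lambda>i. - (\<Sum>t | b t = i. v t))"
    by (simp add: inner_stack inner_add_right inner_sum_right sum_negf inner_commute
        flip: sum_inner_fibres)
  finally show "stack p q \<bullet> (?A *v stack u v) = \<dots>" .
qed

theorem lemma7p1:
  fixes \<phi> :: "'n::finite \<Rightarrow> real^'d::finite \<Rightarrow> real"
    and w :: "real^'d" and \<alpha> :: "'n \<Rightarrow> real^'d"
    and B :: "'n set" and b :: "'t::finite \<Rightarrow> 'n"
  assumes "\<And>i. twice_differentiable (\<phi> i)"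
    and "\<And>i. strictly_convex (\<phi> i)"
    and "bij_betw b UNIV B"
    and "invertible (mean_hessian \<phi> \<alpha>)"
  shows "snr_step 1 (snm_F \<phi>) (snm_sketch \<phi> b (stack w \<alpha>)) (stack w \<alpha>)
       = stack (snm_w \<phi> \<alpha>) (\<lambda>i. if i \<in> B then snm_w \<phi> \<alpha> else \<alpha> i)"
proof -
  let ?H = "mean_hessian \<phi> \<alpha>" and ?x = "stack w \<alpha>" and ?w' = "snm_w \<phi> \<alpha>"
  let ?y = "stack ?w' (\<lambda>i. if i \<in> B then ?w' else \<alpha> i)"
  let ?S = "snm_sketch \<phi> b ?x"
  let ?A = "DT (snm_F \<phi>) ?x ** ?S"
  note tw = assms(1)
  have "inj b" "range b = B" using assms(3) by (auto simp: bij_betw_def)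
  then have fibre: "{t. b t = b s} = {s}" for s by (auto dest: injD)
  have Hinv: "matrix_inv ?H ** ?H = mat 1" "?H ** matrix_inv ?H = mat 1"
    using matrix_inv[OF assms(4)] by auto
  have A: "?A *v stack u v = stack (?H *v u + (\<Sum>t\<in>UNIV. v t)) (\<lambda>i. - (\<Sum>t | b t = i. v t))" for u v
    by (simp add: sketched_DT_mult[OF tw])
  show ?thesis
  proof (rule snr_step_eqI)
    fix z assume "?A *v z = 0"
    moreover define u v where "u = w_part z" and "v = \<alpha>_part z"
    ultimately have "stack (?H *v u + (\<Sum>t\<in>UNIV. v t)) (\<lambda>i. - (\<Sum>t | b t = i. v t)) = stack 0 (\<lambda>_. 0)"
      using A[of u v] by (simp add: stack_parts stack_0)
    then have 1: "?H *v u + (\<Sum>t\<in>UNIV. v t) = 0" and 2: "\<And>i. (\<Sum>t | b t = i. v t) = 0"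
      by (auto simp: stack_eq_iff fun_eq_iff)
    have v: "v = (\<lambda>_. 0)"
    proof
      \<comment> \<open>Injectivity of \<open>b\<close> makes the fibre over \<open>b s\<close> a
        singleton, so its sum is \<open>v s\<close> alone.\<close>
      fix s show "v s = 0" using 2[of "b s"] by (simp add: fibre)
    qed
    with 1 have "matrix_inv ?H *v (?H *v u) = 0" by simp
    then have "u = 0" by (simp add: matrix_vector_mul_assoc Hinv)
    with v show "z = 0" by (metis u_def v_def stack_parts stack_0)
  next
    \<comment> \<open>The trailing blocks of \<open>?A *v stack u v\<close> force this
      \<open>v\<close>; the leading block then gives an equation for \<open>u\<close>, solved by
      inverting \<open>?H\<close>.\<close>
    define v where "v t = ?w' - \<alpha> (b t)" for t
    define u where "u = matrix_inv ?H *v (w - ?w' - (\<Sum>t\<in>UNIV. v t))"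
    have "?H *v u = w - ?w' - (\<Sum>t\<in>UNIV. v t)"
      by (simp add: u_def matrix_vector_mul_assoc Hinv)
    moreover have "\<alpha> i - (if i \<in> B then ?w' else \<alpha> i) = - (\<Sum>t | b t = i. v t)" for i
    proof (cases "i \<in> B")
      case True
      then obtain s where "i = b s" using \<open>range b = B\<close> by auto
      with True show ?thesis by (simp add: fibre v_def)
    next
      case False
      then have "{t. b t = i} = {}" using \<open>range b = B\<close> by auto
      with False show ?thesis by simp
    qed
    ultimately show "?x - ?y = ?A *v stack u v"
      by (simp add: A stack_diff)
  next
    \<comment> \<open>This Newton equation makes the leading block of the sketched residual equal to
      \<open>?H *v (w - ?w')\<close>. In the other blocks \<open>?w'\<close> cancels, since each
      \<open>b t\<close> lies in \<open>B\<close>.\<close>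
    have "?H *v ?w' = (1 / real CARD('n)) *\<^sub>R (\<Sum>i\<in>UNIV. hessian (\<phi> i) (\<alpha> i) *v \<alpha> i)
        - (1 / real CARD('n)) *\<^sub>R (\<Sum>i\<in>UNIV. gradient (\<phi> i) (\<alpha> i))"
      by (simp add: snm_w_def matrix_vector_mul_assoc Hinv)
    moreover have "b t \<in> B" for t using \<open>range b = B\<close> by auto
    ultimately show "transpose ?S *v snm_F \<phi> ?x = transpose ?A *v (?x - ?y)"
      by (simp add: snm_F_def transpose_snm_sketch_mult[OF tw] stack_diff
          transpose_sketched_DT_mult[OF tw] stack_eq_iff matrix_vector_mult_diff_distrib
          mean_hessian_mult[of _ _ w] sum_subtractf scaleR_diff_right)
  qed
qed

end
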